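(* Let $\boldsymbol{A}$ be an $m\times n$ interval matrix, and let $\boldsymbol{b}$ and $\boldsymbol{c}$ be interval vectors of dimensions $m$ and $n$, respectively. Let $\Sigma\subseteq\mathbb{R}^n$ be the set of all robust optimal solutions of the interval linear program $\min c^Tx$ subject to $Ax=b,\ x\geq 0$ (with $A\in\boldsymbol{A}$, $b\in\boldsymbol{b}$, $c\in\boldsymbol{c}$). Then $\Sigma$ is the union of at most $\binom{n}{\lfloor n/2\rfloor}$ convex polyhedral sets.
   Context: Inequalities between matrices or vectors are entrywise. For given $\underline{A}\le\overline{A}$ in $\mathbb{R}^{m\times n}$, the interval matrix is $\boldsymbol{A}=\{A\in\mathbb{R}^{m\times n} : \underline{A}\le A\le\overline{A}\}$; interval vectors $\boldsymbol{b}=\{b\in\mathbb{R}^m:\underline{b}\le b\le\overline{b}\}$ and $\boldsymbol{c}=\{c\in\mathbb{R}^n:\underline{c}\le c\le\overline{c}\}$ are defined in the same way. A point $x^*\in\mathbb{R}^n$ is called a robust optimal solution if for every $c\in\boldsymbol{c}$ and every $A\in\boldsymbol{A}$ there exists $b\in\boldsymbol{b}$ such that $x^*$ is an optimal solution (in particular feasible) of the linear program $\min c^Tx$ subject to $Ax=b,\ x\ge 0$. *)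

theory Defs
  imports "HOL-Analysis.Analysis"
begin

text \<open>
  The order on \<^typ>\<open>real ^ 'n\<close> and, by nesting, on \<^typ>\<open>real ^ 'n ^ 'm\<close> is the entrywise one, so
  the order intervals \<open>{l..u}\<close> below are exactly interval vectors and interval matrices.
\<close>

definition lp_feasible :: "real ^ 'n ^ 'm \<Rightarrow> real ^ 'm \<Rightarrow> (real ^ 'n) set" where
  "lp_feasible A b = {x. A *v x = b \<and> 0 \<le> x}"

definition lp_optimal :: "real ^ 'n ^ 'm \<Rightarrow> real ^ 'm \<Rightarrow> real ^ 'n \<Rightarrow> (real ^ 'n) set" where
  "lp_optimal A b c = {x \<in> lp_feasible A b. \<forall>y \<in> lp_feasible A b. c \<bullet> x \<le> c \<bullet> y}"

definition robust_optimal ::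
  "(real ^ 'n ^ 'm) set \<Rightarrow> (real ^ 'm) set \<Rightarrow> (real ^ 'n) set \<Rightarrow> (real ^ 'n) set" where
  "robust_optimal \<A> \<B> \<C> = {x. \<forall>c \<in> \<C>. \<forall>A \<in> \<A>. \<exists>b \<in> \<B>. x \<in> lp_optimal A b c}"

end

theory Submission
  imports Defs
begin

text \<open>
  For a fixed matrix \<open>A\<close> and cost \<open>c\<close>, whether a point \<open>x \<ge> 0\<close> is optimal among all nonnegative
  points with the same image under \<open>A\<close> depends only on the support of \<open>x\<close>: optimality says that no
  direction in the kernel of \<open>A\<close> that stays nonnegative off the support decreases the cost, and
  shrinking the support leaves fewer such directions.  So optimality passes from \<open>x\<close> to every
  nonnegative point supported inside the support of \<open>x\<close> (\<open>lp_optimal_support_mono\<close>).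

  Since \<open>A x = b\<close> determines \<open>b\<close>, a robust optimal solution is a nonnegative \<open>x\<close> whose images
  \<open>A x\<close> all lie in the box of right-hand sides and which is optimal in the above sense for all \<open>A\<close>
  and \<open>c\<close>.  The first requirement is polyhedral; the second is inherited by smaller supports.
  Hence the solution set is the union, over the supports \<open>I\<close> that are inclusion-maximal among the
  supports of solutions, of the polyhedra of robustly feasible points supported in \<open>I\<close>.  These
  maximal supports form an antichain of subsets of the \<open>n\<close> indices, so Sperner's theorem
  (\<open>Sperner\<close>), derived from the Lubell-Yamamoto-Meshalkin inequality (\<open>LYM_inequality\<close>), bounds
  their number by the middle binomial coefficient.
\<close>

section \<open>Sperner's theorem\<close>

text \<open>
  The summand of \<open>X\<close> counts the orderings of \<open>S\<close> in which the elements of \<open>X\<close> come first; an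
  ordering is counted at most once because its initial segments form a chain.  The induction
  conditions on the last element \<open>x\<close> of the ordering: the members of \<open>F\<close> avoiding \<open>x\<close> form an
  antichain in \<open>S - {x}\<close>, and a set \<open>X\<close> is met in this way for each of the \<open>card S - card X\<close>
  elements outside it.  The set \<open>S\<close> itself is never met, but if it belongs to \<open>F\<close>, it is the
  only member.
\<close>
lemma LYM_inequality:
  assumes "finite S" and "F \<subseteq> Pow S"
    and "\<And>X Y. X \<in> F \<Longrightarrow> Y \<in> F \<Longrightarrow> X \<subseteq> Y \<Longrightarrow> X = Y"
  shows "(\<Sum>X\<in>F. fact (card X) * fact (card S - card X)) \<le> (fact (card S) :: nat)"
  using assms
proof (induction "card S" arbitrary: S F)
  case 0
  then have "F \<subseteq> {{}}" by auto
  then have "F = {} \<or> F = {{}}" by blast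
  then show ?case by auto
next
  case (Suc n)
  have finF: "finite F"
    using Suc.prems by (meson finite_Pow_iff finite_subset)
  have cS: "card S = Suc n" using Suc.hyps by simp
  show ?case
  proof (cases "S \<in> F")
    case True
    then have "F = {S}" using Suc.prems by blast
    then show ?thesis by simp
  next
    case False
    define G where "G x = {X\<in>F. x \<notin> X}" for x
    have IH: "(\<Sum>X\<in>G x. fact (card X) * fact (n - card X)) \<le> (fact n :: nat)" if "x \<in> S" for x
    proof -
      have "card (S - {x}) = n" using that cS by simp
      moreover have "G x \<subseteq> Pow (S - {x})" using Suc.prems(2) by (auto simp: G_def)
      moreover have "finite (S - {x})" using Suc.prems(1) by simp
      moreover have "X = Y" if "X \<in> G x" "Y \<in> G x" "X \<subseteq> Y" for X Y
        using Suc.prems(3) that by (simp add: G_def)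
      ultimately show ?thesis
        using Suc.hyps(1)[of "S - {x}" "G x"] by simp
    qed
    have weight: "fact (card X) * fact (card S - card X)
        = (\<Sum>x\<in>S - X. fact (card X) * fact (n - card X) :: nat)" if "X \<in> F" for X
    proof -
      have "X \<subset> S" using that False Suc.prems(2) by blast
      then have "card X < card S" using Suc.prems(1) by (simp add: psubset_card_mono)
      then have "card S - card X = Suc (n - card X)" using cS by simp
      moreover have "card (S - X) = card S - card X"
        using \<open>X \<subset> S\<close> Suc.prems(1) by (meson card_Diff_subset finite_subset psubset_imp_subset)
      ultimately show ?thesis by (simp add: algebra_simps)
    qed
    have "(\<Sum>X\<in>F. fact (card X) * fact (card S - card X))
        = (\<Sum>X\<in>F. \<Sum>x\<in>S - X. fact (card X) * fact (n - card X) :: nat)"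
      by (intro sum.cong refl weight)
    also have "\<dots> = (\<Sum>X\<in>F. \<Sum>x\<in>{x\<in>S. x \<notin> X}. fact (card X) * fact (n - card X))"
      by (simp add: set_diff_eq)
    also have "\<dots> = (\<Sum>x\<in>S. \<Sum>X\<in>G x. fact (card X) * fact (n - card X))"
      unfolding G_def using finF Suc.prems(1) by (rule sum.swap_restrict)
    also have "\<dots> \<le> (\<Sum>x\<in>S. fact n)"
      by (intro sum_mono IH)
    also have "\<dots> = fact (card S)"
      by (simp add: cS)
    finally show ?thesis .
  qed
qed

theorem Sperner:
  assumes "finite S" and "F \<subseteq> Pow S"
    and "\<And>X Y. X \<in> F \<Longrightarrow> Y \<in> F \<Longrightarrow> X \<subseteq> Y \<Longrightarrow> X = Y"
  shows "card F \<le> card S choose (card S div 2)"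
proof -
  let ?n = "card S"
  let ?M = "?n choose (?n div 2)"
  have le: "fact ?n \<le> fact (card X) * fact (?n - card X) * ?M" if "X \<in> F" for X
  proof -
    have "card X \<le> ?n" using that assms(1,2) by (auto intro: card_mono)
    then have "fact ?n = fact (card X) * fact (?n - card X) * (?n choose card X)"
      by (simp add: binomial_fact_lemma)
    also have "\<dots> \<le> fact (card X) * fact (?n - card X) * ?M"
      by (intro mult_left_mono binomial_maximum) simp
    finally show ?thesis .
  qed
  have "card F * fact ?n = (\<Sum>X\<in>F. fact ?n)" by simp
  also have "\<dots> \<le> (\<Sum>X\<in>F. fact (card X) * fact (?n - card X) * ?M)"
    by (intro sum_mono le)
  also have "\<dots> = (\<Sum>X\<in>F. fact (card X) * fact (?n - card X)) * ?M"
    by (simp add: sum_distrib_right)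
  also have "\<dots> \<le> fact ?n * ?M"
    by (intro mult_right_mono LYM_inequality assms) auto
  finally show ?thesis by (simp add: mult.commute)
qed

section \<open>Optimality and supports\<close>

definition support :: "real ^ 'n \<Rightarrow> 'n set" where
  "support x = {i. x $ i \<noteq> 0}"

lemma support_subset_imp_scaled_le:
  fixes x x' :: "real ^ 'n"
  assumes "0 \<le> x" and "support x' \<subseteq> support x"
  shows "\<exists>t>0. t *\<^sub>R x' \<le> x"
proof -
  have "\<exists>s>0. s * x' $ i \<le> x $ i" for i
  proof (cases "x $ i = 0")
    case True
    then have "x' $ i = 0" using assms(2) by (auto simp: support_def)
    then show ?thesis using True by (intro exI[of _ 1]) simp
  next
    case False
    then have pos: "x $ i > 0" using assms(1) by (metis less_eq_vec_def order_le_less zero_index)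
    let ?s = "x $ i / (\<bar>x' $ i\<bar> + 1)"
    have "?s * x' $ i \<le> ?s * (\<bar>x' $ i\<bar> + 1)"
      by (intro mult_left_mono) (use pos in auto)
    also have "\<dots> = x $ i" by (simp add: add_nonneg_eq_0_iff)
    finally show ?thesis using pos by (intro exI[of _ ?s]) (simp add: add_nonneg_pos)
  qed
  then obtain s where s: "\<And>i. s i > 0" "\<And>i. s i * x' $ i \<le> x $ i" by metis
  define t where "t = Min (range s)"
  have "t > 0" using s(1) by (simp add: t_def)
  moreover have "t * x' $ i \<le> x $ i" for i
  proof (cases "x' $ i \<ge> 0")
    case True
    have "t \<le> s i" by (simp add: t_def)
    then have "t * x' $ i \<le> s i * x' $ i" using True by (rule mult_right_mono)
    then show ?thesis using s(2)[of i] by simp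
  next
    case False
    then have "t * x' $ i \<le> 0" using \<open>t > 0\<close> by (simp add: mult_le_0_iff)
    also have "0 \<le> x $ i" using assms(1) by (simp add: less_eq_vec_def)
    finally show ?thesis .
  qed
  ultimately show ?thesis by (auto simp: less_eq_vec_def)
qed

text \<open>
  A competitor \<open>y\<close> that beats \<open>x'\<close> yields the direction \<open>y - x'\<close> in the kernel of \<open>A\<close>.  A small
  step from \<open>x\<close> in this direction stays nonnegative, because \<open>x'\<close> vanishes wherever \<open>x\<close> does, and
  would improve on \<open>x\<close>.
\<close>
lemma lp_optimal_support_mono:
  fixes A :: "real ^ 'n ^ 'm"
  assumes opt: "x \<in> lp_optimal A (A *v x) c"
    and nonneg: "0 \<le> x'" and supp: "support x' \<subseteq> support x"
  shows "x' \<in> lp_optimal A (A *v x') c"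
proof -
  have "0 \<le> x" using opt by (simp add: lp_optimal_def lp_feasible_def)
  then obtain t where t: "t > 0" "t *\<^sub>R x' \<le> x"
    using support_subset_imp_scaled_le supp by blast
  have "c \<bullet> x' \<le> c \<bullet> y" if y: "A *v y = A *v x'" "0 \<le> y" for y
  proof -
    let ?z = "x + t *\<^sub>R (y - x')"
    have "0 \<le> ?z $ i" for i
    proof -
      have "t * x' $ i \<le> x $ i" and "0 \<le> t * y $ i"
        using t y(2) by (auto simp: less_eq_vec_def)
      then show ?thesis by (simp add: algebra_simps)
    qed
    then have "0 \<le> ?z" by (simp add: less_eq_vec_def)
    moreover have "A *v ?z = A *v x"
      using y(1)
      by (simp add: matrix_vector_right_distrib matrix_vector_mult_diff_distrib
          matrix_vector_mult_scaleR)
    ultimately have "c \<bullet> x \<le> c \<bullet> ?z"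
      using opt by (simp add: lp_optimal_def lp_feasible_def)
    then have "0 \<le> t * (c \<bullet> y - c \<bullet> x')"
      by (simp add: inner_add_right inner_diff_right)
    then show ?thesis using t(1) by (simp add: zero_le_mult_iff)
  qed
  then show ?thesis using nonneg by (simp add: lp_optimal_def lp_feasible_def)
qed

section \<open>Robust feasibility and robust optimality\<close>

text \<open>
  On nonnegative points the extreme images under an interval matrix are attained at its two
  end matrices, so only these enter.
\<close>
definition robust_feasible_on ::
  "'n set \<Rightarrow> real ^ 'n ^ 'm \<Rightarrow> real ^ 'n ^ 'm \<Rightarrow> real ^ 'm \<Rightarrow> real ^ 'm \<Rightarrow> (real ^ 'n) set" where
  "robust_feasible_on I A_lo A_hi b_lo b_hi =
     {x. 0 \<le> x \<and> support x \<subseteq> I \<and> b_lo \<le> A_lo *v x \<and> A_hi *v x \<le> b_hi}"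

lemma polyhedron_robust_feasible_on:
  "polyhedron (robust_feasible_on I A_lo A_hi b_lo b_hi)"
proof -
  have "robust_feasible_on I A_lo A_hi b_lo b_hi =
      (\<Inter>i. {x. axis i 1 \<bullet> x \<ge> 0}) \<inter> (\<Inter>i\<in>-I. {x. axis i 1 \<bullet> x = 0}) \<inter>
      ((\<Inter>j. {x. A_lo $ j \<bullet> x \<ge> b_lo $ j}) \<inter> (\<Inter>j. {x. A_hi $ j \<bullet> x \<le> b_hi $ j}))"
    by (auto simp: robust_feasible_on_def support_def less_eq_vec_def inner_axis'
        matrix_vector_mul_component)
  then show ?thesis
    by (auto intro!: polyhedron_Int polyhedron_Inter polyhedron_halfspace_ge
        polyhedron_halfspace_le polyhedron_hyperplane)
qed

lemma matrix_vector_mult_left_mono: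
  fixes A B :: "real ^ 'n ^ 'm"
  assumes "A \<le> B" and "0 \<le> x"
  shows "A *v x \<le> B *v x"
  using assms
  by (auto simp: less_eq_vec_def matrix_vector_mult_def intro!: sum_mono mult_right_mono)

lemma robust_optimal_iff:
  "x \<in> robust_optimal \<A> \<B> \<C> \<longleftrightarrow>
     (\<forall>c\<in>\<C>. \<forall>A\<in>\<A>. A *v x \<in> \<B> \<and> x \<in> lp_optimal A (A *v x) c)"
proof -
  have "A *v x = b" if "x \<in> lp_optimal A b c" for A b c
    using that by (simp add: lp_optimal_def lp_feasible_def)
  then show ?thesis unfolding robust_optimal_def by fast
qed

lemma robust_optimal_imp_robust_feasible_on:
  assumes "A_lo \<le> A_hi" and "c_lo \<le> c_hi"
    and "x \<in> robust_optimal {A_lo..A_hi} {b_lo..b_hi} {c_lo..c_hi}" and "support x \<subseteq> I"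
  shows "x \<in> robust_feasible_on I A_lo A_hi b_lo b_hi"
proof -
  have "A_lo \<in> {A_lo..A_hi}" "A_hi \<in> {A_lo..A_hi}" "c_lo \<in> {c_lo..c_hi}"
    using assms(1,2) by simp_all
  then have "A_lo *v x \<in> {b_lo..b_hi}" "A_hi *v x \<in> {b_lo..b_hi}"
    "x \<in> lp_optimal A_lo (A_lo *v x) c_lo"
    using assms(3) unfolding robust_optimal_iff by blast+
  then show ?thesis
    using assms(4) by (auto simp: robust_feasible_on_def lp_optimal_def lp_feasible_def)
qed

lemma robust_feasible_on_support_imp_robust_optimal:
  assumes opt: "z \<in> robust_optimal {A_lo..A_hi} {b_lo..b_hi} {c_lo..c_hi}"
    and feas: "x \<in> robust_feasible_on (support z) A_lo A_hi b_lo b_hi"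
  shows "x \<in> robust_optimal {A_lo..A_hi} {b_lo..b_hi} {c_lo..c_hi}"
  unfolding robust_optimal_iff
proof (intro ballI conjI)
  fix c A assume c: "c \<in> {c_lo..c_hi}" and A: "A \<in> {A_lo..A_hi}"
  have x: "0 \<le> x" "support x \<subseteq> support z" "b_lo \<le> A_lo *v x" "A_hi *v x \<le> b_hi"
    using feas by (auto simp: robust_feasible_on_def)
  have "A_lo *v x \<le> A *v x" "A *v x \<le> A_hi *v x"
    using A x(1) by (auto intro: matrix_vector_mult_left_mono)
  then show "A *v x \<in> {b_lo..b_hi}"
    using x(3,4) by auto
  have "z \<in> lp_optimal A (A *v z) c"
    using opt c A by (simp add: robust_optimal_iff)
  then show "x \<in> lp_optimal A (A *v x) c"
    using x(1,2) by (rule lp_optimal_support_mono)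
qed

theorem proposition1:
  fixes A_lo A_hi :: "real ^ 'n ^ 'm"
    and b_lo b_hi :: "real ^ 'm"
    and c_lo c_hi :: "real ^ 'n"
  assumes "A_lo \<le> A_hi" and "b_lo \<le> b_hi" and "c_lo \<le> c_hi"
  shows "\<exists>\<P> :: (real ^ 'n) set set.
           finite \<P> \<and>
           card \<P> \<le> CARD('n) choose (CARD('n) div 2) \<and>
           (\<forall>P \<in> \<P>. polyhedron P) \<and>
           robust_optimal {A_lo..A_hi} {b_lo..b_hi} {c_lo..c_hi} = \<Union>\<P>"
proof -
  let ?\<Sigma> = "robust_optimal {A_lo..A_hi} {b_lo..b_hi} {c_lo..c_hi}"
  let ?P = "\<lambda>I. robust_feasible_on I A_lo A_hi b_lo b_hi"
  define M where "M = {I \<in> support ` ?\<Sigma>. \<forall>J \<in> support ` ?\<Sigma>. I \<subseteq> J \<longrightarrow> I = J}"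
  have "card (?P ` M) \<le> card M"
    by (rule card_image_le) simp
  also have "card M \<le> CARD('n) choose (CARD('n) div 2)"
    by (rule Sperner) (auto simp: M_def)
  finally have "card (?P ` M) \<le> CARD('n) choose (CARD('n) div 2)" .
  moreover have "?\<Sigma> \<subseteq> \<Union> (?P ` M)"
  proof
    fix x assume x: "x \<in> ?\<Sigma>"
    have "\<exists>I\<in>support ` ?\<Sigma>. support x \<subseteq> I \<and> (\<forall>J\<in>support ` ?\<Sigma>. I \<subseteq> J \<longrightarrow> I = J)"
      by (rule finite_has_maximal2) (use x in auto)
    then obtain I where "I \<in> M" "support x \<subseteq> I" by (auto simp: M_def)
    then show "x \<in> \<Union> (?P ` M)"
      using robust_optimal_imp_robust_feasible_on[OF assms(1,3) x] by blast
  qed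
  moreover have "\<Union> (?P ` M) \<subseteq> ?\<Sigma>"
    using robust_feasible_on_support_imp_robust_optimal by (fastforce simp: M_def)
  ultimately show ?thesis
    by (intro exI[of _ "?P ` M"]) (auto simp: polyhedron_robust_feasible_on)
qed

end
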